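(* Let $n\geq 1$ be an odd integer, let $p$ be a prime and let $r$ be a positive integer. If $p$ is odd and $r>\log_p n+1$, then $S_n(p^r)=0$. If $p=2$, then $S_n(2^r)=0$ for all $r>1$.
   Context: For an integer $q\ge 3$, let $\zeta=e^{2\pi i/q}$. For integers $u,v$ the Kloosterman sum is $$K(u,v;q)=\sum_{\substack{0<x\le q\\ (x,q)=1}}\zeta^{ux+v\bar x},$$ where $\bar x$ denotes the multiplicative inverse of $x$ in $(\mathbb{Z}/q\mathbb{Z})^*$. For a positive integer $n$, the $n$-th power moment is $$S_n(q)=\sum_{u=1}^q K(u,1;q)^n.$$ Here $\log_p$ is the real logarithm to base $p$. *)

theory Defs
  imports Complex_Main "HOL-Number_Theory.Number_Theory" "HOL-Number_Theory.Modular_Inverse"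
begin

definition zeta :: "nat \<Rightarrow> complex" where
  "zeta q = exp (2 * complex_of_real pi * \<i> / of_nat q)"

(* The inverse is taken to be the representative in [0, q). Since zeta q is a q-th root
   of unity, the sum depends only on the residue class of the inverse. *)
definition kloosterman :: "int \<Rightarrow> int \<Rightarrow> nat \<Rightarrow> complex" where
  "kloosterman u v q =
     (\<Sum>x | 0 < x \<and> x \<le> int q \<and> coprime x (int q).
        zeta q powi (u * x + v * modular_inverse (int q) x))"

definition kloosterman_moment :: "nat \<Rightarrow> nat \<Rightarrow> complex" where
  "kloosterman_moment n q = (\<Sum>u = 1..int q. kloosterman u 1 q ^ n)"

end

theory Submission
  imports Defs "HOL-Analysis.Complex_Transcendental"
begin

text \<open>
  Write \<open>e(m) = \<zeta>\<^sup>m\<close>, a function of \<open>m\<close> modulo \<open>q\<close>, and \<open>K(u) = K(u, 1; q)\<close>.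

  For even \<open>q\<close> every \<open>x\<close> in the Kloosterman sum is odd, so that moving \<open>u\<close> by \<open>q/2\<close> changes the
  sign of every term. Hence \<open>K(u + q/2) = - K(u)\<close>, and the odd moments cancel in pairs.

  Let \<open>q = p\<^sup>r\<close> with \<open>p\<close> odd and \<open>r \<ge> 2\<close>, and call the residues congruent to 1 modulo \<open>p\<close>
  principal. They form a group, on which squaring is a bijection because \<open>x + y\<close> is congruent
  to 2, hence invertible, for principal \<open>x\<close> and \<open>y\<close>. As multiplication of \<open>u\<close> by
  a principal \<open>w\<close> permutes the residues modulo \<open>q\<close>, it suffices to show for each \<open>u\<close> that
  the sum of \<open>K(u w)\<^sup>n\<close> over principal \<open>w\<close> vanishes
  (\<open>sum_kloosterman_power_principal\<close>).

  Only the \<open>x\<close> with \<open>u x\<^sup>2 \<equiv> 1\<close> modulo \<open>p\<close> contribute to \<open>K(u)\<close>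
  (\<open>kloosterman_stationary\<close>). If there are none for \<open>u\<close>, then there are none for any \<open>u w\<close> and all the
  terms are 0. Otherwise \<open>u\<close> is a square \<open>c\<^sup>2\<close> modulo \<open>q\<close>, the numbers \<open>u w\<close> are the squares
  \<open>(c s)\<^sup>2\<close> with \<open>s\<close> principal, and \<open>K(v\<^sup>2) = K(v, v; q)\<close> is the sum of the contributions of
  \<open>x \<equiv> 1\<close> and \<open>x \<equiv> -1\<close>. Putting \<open>x = y\<^sup>2\<close> in the first one,
  \<open>v (x + 1/x) = 2 v + v (y - 1/y)\<^sup>2\<close>, and \<open>y - 1/y\<close> runs through the multiples of \<open>p\<close>. So the
  contribution is \<open>e(2 v) G(v)\<close>, where \<open>G(v)\<close> is the sum of \<open>e(v z\<^sup>2)\<close> over the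
  multiples \<open>z\<close> of \<open>p\<close>. A principal factor of \<open>v\<close> is a square and is absorbed by \<open>z\<close>, which
  gives \<open>K((c s)\<^sup>2) = e(2 c s) G(c) + e(- 2 c s) G(- c)\<close>
  (\<open>kloosterman_square_class\<close>).

  By the binomial theorem \<open>K((c s)\<^sup>2)\<^sup>n\<close> is a combination, with coefficients independent of
  \<open>s\<close>, of the \<open>e(2 c (2 k - n) s)\<close> for \<open>k \<le> n\<close>. The sum of \<open>e(m s)\<close> over principal \<open>s\<close>
  vanishes unless \<open>p\<^sup>r\<^sup>-\<^sup>1\<close> divides \<open>m\<close>. Here \<open>2 k - n\<close> is odd, hence nonzero, and at most
  \<open>n < p\<^sup>r\<^sup>-\<^sup>1\<close> in absolute value, so all these sums vanish.
\<close>

section \<open>Sums over residue classes\<close>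

text \<open>
  An injective map of a finite set of residue classes to itself is onto. This makes most of the
  substitutions in the exponential sums below reversible and gives square roots modulo \<open>q\<close>
  without Hensel lifting.
\<close>

lemma residue_endo_bij:
  fixes q :: int and f :: "int \<Rightarrow> int"
  assumes q: "q > 0"
    and P: "\<And>x y. [x = y] (mod q) \<Longrightarrow> P x \<Longrightarrow> P y"
    and maps: "\<And>x. P x \<Longrightarrow> P (f x)"
    and inj: "\<And>x y. P x \<Longrightarrow> P y \<Longrightarrow> [f x = f y] (mod q) \<Longrightarrow> [x = y] (mod q)"
  shows "bij_betw (\<lambda>x. f x mod q) {x \<in> {0..<q}. P x} {x \<in> {0..<q}. P x}"
proof -
  let ?S = "{x \<in> {0..<q}. P x}"
  have fin: "finite ?S"
    by (rule finite_subset[of _ "{0..<q}"]) auto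
  have inj': "inj_on (\<lambda>x. f x mod q) ?S"
  proof (rule inj_onI)
    fix x y assume x: "x \<in> ?S" and y: "y \<in> ?S" and eq: "f x mod q = f y mod q"
    have "[x = y] (mod q)"
      by (rule inj) (use x y eq in \<open>auto simp: Cong.cong_def\<close>)
    then show "x = y"
      using x y by (auto intro: cong_less_imp_eq_int)
  qed
  have "P (f x mod q)" if "P x" for x
    using P[of "f x" "f x mod q"] maps[OF that] by (simp add: Cong.cong_def)
  then have "(\<lambda>x. f x mod q) ` ?S \<subseteq> ?S"
    using q by auto
  then show ?thesis
    using inj' endo_inj_surj[OF fin _ inj'] by (simp add: bij_betw_def)
qed

lemma sum_residue_reindex:
  fixes q :: int and g :: "int \<Rightarrow> 'a::comm_monoid_add"
  assumes "q > 0"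
    and "\<And>x y. [x = y] (mod q) \<Longrightarrow> P x \<Longrightarrow> P y"
    and "\<And>x. P x \<Longrightarrow> P (f x)"
    and "\<And>x y. P x \<Longrightarrow> P y \<Longrightarrow> [f x = f y] (mod q) \<Longrightarrow> [x = y] (mod q)"
    and g: "\<And>x y. P x \<Longrightarrow> [x = y] (mod q) \<Longrightarrow> g x = g y"
  shows "(\<Sum>x | x \<in> {0..<q} \<and> P x. g (f x)) = (\<Sum>x | x \<in> {0..<q} \<and> P x. g x)"
proof -
  have "(\<Sum>x | x \<in> {0..<q} \<and> P x. g (f x)) = (\<Sum>x | x \<in> {0..<q} \<and> P x. g (f x mod q))"
    by (intro sum.cong refl g) (auto intro: assms(3))
  also have "\<dots> = (\<Sum>x | x \<in> {0..<q} \<and> P x. g x)"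
    by (rule sum.reindex_bij_betw[OF residue_endo_bij]) (fact assms)+
  finally show ?thesis .
qed

lemma residue_endo_surj:
  fixes q :: int
  assumes "q > 0"
    and P: "\<And>x y. [x = y] (mod q) \<Longrightarrow> P x \<Longrightarrow> P y"
    and "\<And>x. P x \<Longrightarrow> P (f x)"
    and "\<And>x y. P x \<Longrightarrow> P y \<Longrightarrow> [f x = f y] (mod q) \<Longrightarrow> [x = y] (mod q)"
    and y: "P y"
  obtains x where "P x" "[f x = y] (mod q)"
proof -
  have "y mod q \<in> {x \<in> {0..<q}. P x}"
    using \<open>q > 0\<close> P[OF _ y, of "y mod q"] by simp
  also have "\<dots> = (\<lambda>x. f x mod q) ` {x \<in> {0..<q}. P x}"
    by (rule bij_betw_imp_surj_on[OF residue_endo_bij, symmetric]) (fact assms)+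
  finally obtain x where "P x" "f x mod q = y mod q"
    by auto
  then show ?thesis
    by (intro that) (auto simp: Cong.cong_def)
qed


section \<open>The additive character\<close>

definition add_char :: "nat \<Rightarrow> int \<Rightarrow> complex" where
  "add_char q m = zeta q powi m"

lemma zeta_nonzero [simp]: "zeta q \<noteq> 0"
  by (simp add: zeta_def)

lemma add_char_add: "add_char q (a + b) = add_char q a * add_char q b"
  by (simp add: add_char_def power_int_add)

lemma add_char_0 [simp]: "add_char q 0 = 1"
  by (simp add: add_char_def)

lemma add_char_power: "add_char q (int t * m) = add_char q m ^ t"
  by (induction t) (simp_all add: add_char_add distrib_right)

lemma add_char_eq_1_iff:
  assumes "q > 0"
  shows "add_char q m = 1 \<longleftrightarrow> int q dvd m"
proof -
  have "add_char q m = exp (of_int m * (2 * complex_of_real pi * \<i> / of_nat q))"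
    by (simp add: add_char_def zeta_def exp_power_int)
  also have "\<dots> = exp (\<i> * complex_of_real (2 * pi * of_int m / of_nat q))"
    by (simp add: algebra_simps)
  also have "\<dots> = 1 \<longleftrightarrow> (\<exists>k::int. 2 * pi * of_int m / of_nat q = of_int (2 * k) * pi)"
    by (simp add: exp_eq_1)
  also have "\<dots> \<longleftrightarrow> (\<exists>k::int. (of_int m :: real) = of_int (int q * k))"
    using assms by (simp add: field_simps)
  also have "\<dots> \<longleftrightarrow> int q dvd m"
    by (simp only: of_int_eq_iff dvd_def)
  finally show ?thesis .
qed

lemma add_char_cong:
  assumes "q > 0" "[a = b] (mod int q)"
  shows "add_char q a = add_char q b"
proof -
  have "add_char q (a - b) = 1"
    using assms by (simp add: add_char_eq_1_iff cong_iff_dvd_diff)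
  then show ?thesis
    using add_char_add[of q "a - b" b] by simp
qed


section \<open>Kloosterman sums\<close>

abbreviation inv_mod :: "nat \<Rightarrow> int \<Rightarrow> int" where
  "inv_mod q x \<equiv> modular_inverse (int q) x"

lemma inv_mod_unique:
  assumes "[x * y = 1] (mod int q)"
  shows "[inv_mod q x = y] (mod int q)"
proof -
  have "coprime x (int q)"
    using assms coprime_iff_invertible_int by blast
  then have "[y * (x * inv_mod q x) = y * 1] (mod int q)"
    by (intro cong_mult cong_refl cong_modular_inverse1)
  moreover have "[(x * y) * inv_mod q x = 1 * inv_mod q x] (mod int q)"
    by (intro cong_mult cong_refl assms)
  ultimately show ?thesis
    by (simp add: mult_ac) (metis cong_sym cong_trans)
qed

lemma inv_mod_cong:
  assumes "[x = y] (mod int q)" "coprime x (int q)"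
  shows "[inv_mod q x = inv_mod q y] (mod int q)"
proof (rule inv_mod_unique)
  have "coprime y (int q)"
    using assms cong_imp_coprime by blast
  then have "[y * inv_mod q y = 1] (mod int q)"
    by (rule cong_modular_inverse1)
  then show "[x * inv_mod q y = 1] (mod int q)"
    using assms(1) by (meson cong_scalar_right cong_trans)
qed

lemma kloosterman_term_cong:
  assumes "q > 0" "coprime x (int q)" "[x = y] (mod int q)"
  shows "add_char q (a * x + b * inv_mod q x) = add_char q (a * y + b * inv_mod q y)"
  using assms by (intro add_char_cong cong_add cong_mult cong_refl inv_mod_cong)

lemma kloosterman_eq:
  assumes "q > 1"
  shows "kloosterman a b q =
    (\<Sum>x | x \<in> {0..<int q} \<and> coprime x (int q). add_char q (a * x + b * inv_mod q x))"
proof -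
  have "x < int q" if "x \<le> int q" "coprime x (int q)" for x
    using that assms by (cases "x = int q") auto
  moreover have "0 < x" if "0 \<le> x" "coprime x (int q)" for x
    using that assms by (cases "x = 0") auto
  ultimately show ?thesis
    unfolding kloosterman_def add_char_def by (intro sum.cong) auto
qed

lemma kloosterman_cong:
  assumes "q > 1" "[a = a'] (mod int q)"
  shows "kloosterman a b q = kloosterman a' b q"
  unfolding kloosterman_eq[OF assms(1)] using assms
  by (intro sum.cong refl add_char_cong cong_add cong_mult cong_refl) auto

text \<open>Substitute \<open>v x\<close> for \<open>x\<close>.\<close>

lemma kloosterman_scale:
  assumes q: "q > 1" and v: "coprime v (int q)"
  shows "kloosterman (v * a) b q = kloosterman a (v * b) q"
proof -
  define w where "w = inv_mod q v"
  have vw: "[v * w = 1] (mod int q)"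
    unfolding w_def by (rule cong_modular_inverse1[OF v])
  let ?g = "\<lambda>x. add_char q (a * x + v * b * inv_mod q x)"
  have "kloosterman (v * a) b q =
      (\<Sum>x | x \<in> {0..<int q} \<and> coprime x (int q). ?g (v * x))"
    unfolding kloosterman_eq[OF q]
  proof (intro sum.cong refl add_char_cong)
    fix x assume "x \<in> {x. x \<in> {0..<int q} \<and> coprime x (int q)}"
    then have x: "coprime x (int q)" by simp
    have "[(v * w) * (x * inv_mod q x) = 1 * 1] (mod int q)"
      by (intro cong_mult vw cong_modular_inverse1[OF x])
    then have "[inv_mod q (v * x) = w * inv_mod q x] (mod int q)"
      by (intro inv_mod_unique) (simp add: mult_ac)
    then have "[v * b * inv_mod q (v * x) = v * b * (w * inv_mod q x)] (mod int q)"
      by (intro cong_mult cong_refl)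
    also have "v * b * (w * inv_mod q x) = (v * w) * (b * inv_mod q x)"
      by simp
    also have "[\<dots> = 1 * (b * inv_mod q x)] (mod int q)"
      by (intro cong_mult cong_refl vw)
    finally have "[b * inv_mod q x = v * b * inv_mod q (v * x)] (mod int q)"
      by (simp add: cong_sym)
    then have "[a * (v * x) + b * inv_mod q x = a * (v * x) + v * b * inv_mod q (v * x)] (mod int q)"
      by (intro cong_add cong_refl)
    then show "[v * a * x + b * inv_mod q x = a * (v * x) + v * b * inv_mod q (v * x)] (mod int q)"
      by (simp add: mult_ac)
  qed (use q in auto)
  also have "\<dots> = (\<Sum>x | x \<in> {0..<int q} \<and> coprime x (int q). ?g x)"
  proof (rule sum_residue_reindex)
    show "[x = y] (mod int q)" if "[v * x = v * y] (mod int q)" for x y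
      using that v by (simp add: cong_mult_lcancel)
    show "coprime y (int q)" if "[x = y] (mod int q)" "coprime x (int q)" for x y
      using that by (rule cong_imp_coprime)
    show "?g x = ?g y" if "coprime x (int q)" "[x = y] (mod int q)" for x y
      using q that by (intro kloosterman_term_cong) auto
  qed (use q v in auto)
  also have "\<dots> = kloosterman a (v * b) q"
    by (simp add: kloosterman_eq[OF q])
  finally show ?thesis .
qed

lemma kloosterman_moment_reindex:
  assumes q: "q > 1"
    and inj: "\<And>x y. [f x = f y] (mod int q) \<Longrightarrow> [x = y] (mod int q)"
  shows "kloosterman_moment n q = (\<Sum>u\<in>{0..<int q}. kloosterman (f u) 1 q ^ n)"
proof -
  have "{1..int q} = insert (int q) {1..<int q}" "{0..<int q} = insert 0 {1..<int q}"
    using q by auto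
  \<comment> \<open>The moment runs over 1 to \<open>q\<close>, the canonical residues over 0 to \<open>q - 1\<close>.\<close>
  moreover have "kloosterman (int q) 1 q = kloosterman 0 1 q"
    by (rule kloosterman_cong[OF q]) (simp add: Cong.cong_def)
  ultimately have "kloosterman_moment n q = (\<Sum>u\<in>{0..<int q}. kloosterman u 1 q ^ n)"
    unfolding kloosterman_moment_def by (simp only: sum.insert) simp
  also have "\<dots> = (\<Sum>u | u \<in> {0..<int q} \<and> True. kloosterman u 1 q ^ n)"
    by (simp only: simp_thms Collect_mem_eq)
  also have "\<dots> = (\<Sum>u | u \<in> {0..<int q} \<and> True. kloosterman (f u) 1 q ^ n)"
  proof (rule sum_residue_reindex[symmetric])
    show "kloosterman x 1 q ^ n = kloosterman y 1 q ^ n" if "[x = y] (mod int q)" for x y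
      using kloosterman_cong[OF q that] by simp
  qed (use q inj in auto)
  also have "\<dots> = (\<Sum>u\<in>{0..<int q}. kloosterman (f u) 1 q ^ n)"
    by (simp only: simp_thms Collect_mem_eq)
  finally show ?thesis .
qed


section \<open>Even moduli\<close>

theorem kloosterman_moment_even_modulus:
  assumes "even q" "q > 0" "odd n"
  shows "kloosterman_moment n q = 0"
proof -
  define h where "h = int q div 2"
  have q: "q > 1" and h: "int q = 2 * h" "h > 0"
    using assms by (auto simp: h_def elim!: evenE)
  have "add_char q h ^ 2 = 1"
    using h add_char_power[of q 2 h] add_char_eq_1_iff[of q "2 * h"] q by simp
  moreover have "add_char q h \<noteq> 1"
    using h q by (auto simp: add_char_eq_1_iff dest: zdvd_imp_le)
  ultimately have half: "add_char q h = -1"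
    by (simp add: power2_eq_1_iff)
  have char: "add_char q (h * x) = -1" if "coprime x (int q)" for x
  proof -
    have "odd x"
      using that h by (auto simp: coprime_commute)
    then obtain k where "x = 2 * k + 1"
      by (elim oddE)
    then have "[h * x = h] (mod int q)"
      unfolding h(1) by (simp add: cong_iff_dvd_diff algebra_simps)
    then show ?thesis
      using half add_char_cong q by (metis neq0_conv not_one_less_zero)
  qed
  have neg: "kloosterman (u + h) 1 q = - kloosterman u 1 q" for u
    unfolding kloosterman_eq[OF q] sum_negf[symmetric]
  proof (intro sum.cong refl)
    fix x assume "x \<in> {x. x \<in> {0..<int q} \<and> coprime x (int q)}"
    then have "add_char q (h * x) = -1"
      using char by simp
    then show "add_char q ((u + h) * x + 1 * inv_mod q x) = - add_char q (u * x + 1 * inv_mod q x)"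
      using add_char_add[of q "u * x + 1 * inv_mod q x" "h * x"] by (simp add: algebra_simps)
  qed
  have "kloosterman_moment n q = (\<Sum>u\<in>{0..<int q}. kloosterman (u + h) 1 q ^ n)"
    by (rule kloosterman_moment_reindex[OF q]) (simp add: cong_add_rcancel)
  also have "\<dots> = - (\<Sum>u\<in>{0..<int q}. kloosterman u 1 q ^ n)"
    unfolding neg using \<open>odd n\<close> by (simp add: sum_negf)
  also have "\<dots> = - kloosterman_moment n q"
    by (simp add: kloosterman_moment_reindex[OF q, where f = "\<lambda>u. u"])
  finally show ?thesis
    by simp
qed


section \<open>Odd prime powers\<close>

context
  fixes p r q :: nat
  assumes p: "prime p" "odd p" and r: "r \<ge> 2" and q_def: "q = p ^ r"
begin

lemma q_gt_1: "q > 1"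
  unfolding q_def using p r prime_gt_1_nat by (intro one_less_power) auto

lemma q_pos: "q > 0"
  using q_gt_1 by simp

lemma q_eq: "int q = int p * int p ^ (r - 1)"
  unfolding q_def using r by (cases r) auto

lemma p_dvd_q: "int p dvd int q"
  by (simp add: q_eq)

lemma p_dvd_power: "int p dvd int p ^ (r - 1)"
  using r by (intro dvd_power) auto

lemma q_dvd_power_square: "int q dvd int p ^ (r - 1) * int p ^ (r - 1)"
  unfolding q_eq by (intro mult_dvd_mono p_dvd_power dvd_refl)

lemma cong_mod_p: "[x = y] (mod int q) \<Longrightarrow> [x = y] (mod int p)"
  using cong_dvd_modulus p_dvd_q by blast

lemma coprime_q_iff: "coprime x (int q) \<longleftrightarrow> \<not> int p dvd x"
proof -
  have "coprime x (int q) \<longleftrightarrow> coprime x (int p)"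
    unfolding q_def using r by simp
  also have "\<dots> \<longleftrightarrow> \<not> int p dvd x"
    using p(1) by (metis coprime_commute prime_imp_coprime prime_nat_int_transfer
        coprime_absorb_left not_prime_unit)
  finally show ?thesis .
qed

abbreviation principal :: "int \<Rightarrow> bool" where
  "principal x \<equiv> [x = 1] (mod int p)"

lemma principal_coprime: "principal x \<Longrightarrow> coprime x (int q)"
  using p(1) cong_dvd_iff[of x 1 "int p"] by (auto simp: coprime_q_iff)

lemma principal_cong: "[x = y] (mod int q) \<Longrightarrow> principal x \<Longrightarrow> principal y"
  using cong_mod_p cong_sym cong_trans by blast

lemma principal_mult: "principal x \<Longrightarrow> principal y \<Longrightarrow> principal (x * y)"
  using cong_mult by fastforce

lemma inv_mod_p: "coprime x (int q) \<Longrightarrow> [x * inv_mod q x = 1] (mod int p)"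
  by (intro cong_mod_p cong_modular_inverse1)

lemma principal_inv_mod:
  assumes "principal x"
  shows "principal (inv_mod q x)"
proof -
  have "[x * inv_mod q x = 1 * inv_mod q x] (mod int p)"
    by (intro cong_mult cong_refl assms)
  then show ?thesis
    using inv_mod_p[OF principal_coprime[OF assms]] by (metis cong_sym cong_trans mult_1)
qed

lemma not_p_dvd_2: "\<not> int p dvd 2"
  using p by (metis int_dvd_int_iff of_nat_numeral primes_dvd_imp_eq two_is_prime_nat dvd_refl)

text \<open>
  The injectivity of squaring and of \<open>x - 1/x\<close> on principal residues both come down to
  cancelling a factor congruent to 2, which is a unit because \<open>p\<close> is odd.
\<close>

lemma dvd_mult_unit_2:
  assumes "int q dvd d * a" "[a = 2] (mod int p)"
  shows "int q dvd d"
proof -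
  have "coprime a (int q)"
    using not_p_dvd_2 assms(2) cong_dvd_iff[of a 2 "int p"] by (simp add: coprime_q_iff)
  then show ?thesis
    using assms(1) by (simp add: coprime_dvd_mult_left_iff coprime_commute)
qed

lemma principal_square_inj:
  assumes "principal x" "principal y" "[x * x = y * y] (mod int q)"
  shows "[x = y] (mod int q)"
proof -
  have "int q dvd (x - y) * (x + y)"
    using assms(3) by (simp add: cong_iff_dvd_diff algebra_simps)
  moreover have "[x + y = 2] (mod int p)"
    using cong_add[OF assms(1,2)] by simp
  ultimately have "int q dvd x - y"
    by (rule dvd_mult_unit_2)
  then show ?thesis
    by (simp add: cong_iff_dvd_diff)
qed

lemma sum_principal_square:
  assumes "\<And>x y. principal x \<Longrightarrow> [x = y] (mod int q) \<Longrightarrow> g x = g y"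
  shows "(\<Sum>x | x \<in> {0..<int q} \<and> principal x. g (x * x)) =
    (\<Sum>x | x \<in> {0..<int q} \<and> principal x. g x)"
proof (rule sum_residue_reindex)
  show "0 < int q" using q_pos by simp
  show "principal y" if "[x = y] (mod int q)" "principal x" for x y
    using that by (rule principal_cong)
  show "principal (x * x)" if "principal x" for x
    using that that by (rule principal_mult)
  show "[x = y] (mod int q)" if "principal x" "principal y" "[x * x = y * y] (mod int q)" for x y
    using that by (rule principal_square_inj)
  show "g x = g y" if "principal x" "[x = y] (mod int q)" for x y
    using that by (rule assms)
qed

lemma principal_square_root:
  assumes "principal t"
  obtains s where "principal s" "[s * s = t] (mod int q)"
proof -
  have "\<exists>s. principal s \<and> [s * s = t] (mod int q)"
  proof (rule residue_endo_surj[where q = "int q" and P = principal and f = "\<lambda>x. x * x" and y = t])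
    show "0 < int q" using q_pos by simp
    show "principal y" if "[x = y] (mod int q)" "principal x" for x y
      using that by (rule principal_cong)
    show "principal (x * x)" if "principal x" for x
      using that that by (rule principal_mult)
    show "[x = y] (mod int q)" if "principal x" "principal y" "[x * x = y * y] (mod int q)" for x y
      using that by (rule principal_square_inj)
    show "\<exists>s. principal s \<and> [s * s = t] (mod int q)"
      if "principal x" "[x * x = t] (mod int q)" for x
      using that by blast
  qed (fact assms)
  then show ?thesis
    using that by blast
qed

text \<open>
  Stationary phase. With \<open>Q = p\<^sup>r\<^sup>-\<^sup>1\<close>, replacing \<open>x\<close> by \<open>x (1 + Q t)\<close> permutes the units and
  multiplies the term at \<open>x\<close> by \<open>e(Q t (a x - b/x))\<close>, because \<open>Q\<^sup>2 \<equiv> 0\<close> makes \<open>1 - Q t\<close> the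
  inverse of \<open>1 + Q t\<close>. Averaging over \<open>t < p\<close> removes the terms in which \<open>p\<close> does not divide
  \<open>a x - b/x\<close>.
\<close>

lemma kloosterman_stationary:
  "kloosterman a b q = (\<Sum>x | x \<in> {0..<int q} \<and> coprime x (int q) \<and> [a * x * x = b] (mod int p).
     add_char q (a * x + b * inv_mod q x))"
proof -
  define Q where "Q = int p ^ (r - 1)"
  define S where "S = {x. x \<in> {0..<int q} \<and> coprime x (int q)}"
  define g where "g x = add_char q (a * x + b * inv_mod q x)" for x
  define d where "d x = a * x - b * inv_mod q x" for x
  define w where "w x = add_char q (Q * d x)" for x
  have fin: "finite S"
    unfolding S_def by (rule finite_subset[of _ "{0..<int q}"]) auto
  have shift: "(\<Sum>x\<in>S. g x * w x ^ t) = kloosterman a b q" for t :: nat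
  proof -
    have unit: "principal (1 + Q * int t)"
      using p_dvd_power by (simp add: cong_iff_dvd_diff Q_def)
    have "(\<Sum>x\<in>S. g x * w x ^ t) = (\<Sum>x\<in>S. g (x * (1 + Q * int t)))"
    proof (rule sum.cong[OF refl])
      fix x assume "x \<in> S"
      then have x: "coprime x (int q)" by (simp add: S_def)
      have "int q dvd Q * Q"
        unfolding Q_def by (rule q_dvd_power_square)
      then have "[1 - Q * Q * (int t * int t) = 1] (mod int q)"
        by (simp add: cong_iff_dvd_diff)
      then have "[(x * inv_mod q x) * (1 - Q * Q * (int t * int t)) = 1 * 1] (mod int q)"
        by (intro cong_mult cong_modular_inverse1[OF x])
      moreover have "(x * inv_mod q x) * (1 - Q * Q * (int t * int t)) =
          x * (1 + Q * int t) * (inv_mod q x * (1 - Q * int t))"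
        by (simp add: algebra_simps)
      ultimately have "[inv_mod q (x * (1 + Q * int t)) = inv_mod q x * (1 - Q * int t)] (mod int q)"
        by (intro inv_mod_unique) simp
      then have "g (x * (1 + Q * int t)) =
          add_char q (a * (x * (1 + Q * int t)) + b * (inv_mod q x * (1 - Q * int t)))"
        unfolding g_def by (intro add_char_cong[OF q_pos] cong_add cong_mult cong_refl)
      also have "a * (x * (1 + Q * int t)) + b * (inv_mod q x * (1 - Q * int t)) =
          (a * x + b * inv_mod q x) + int t * (Q * d x)"
        by (simp add: d_def algebra_simps)
      finally show "g x * w x ^ t = g (x * (1 + Q * int t))"
        by (simp only: add_char_add add_char_power g_def w_def)
    qed
    also have "\<dots> = (\<Sum>x\<in>S. g x)"
      unfolding S_def
    proof (rule sum_residue_reindex)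
      show "coprime y (int q)" if "[x = y] (mod int q)" "coprime x (int q)" for x y
        using that by (rule cong_imp_coprime)
      show "coprime (x * (1 + Q * int t)) (int q)" if "coprime x (int q)" for x
        using that principal_coprime[OF unit] by simp
      show "[x = y] (mod int q)" if "[x * (1 + Q * int t) = y * (1 + Q * int t)] (mod int q)" for x y
        using that principal_coprime[OF unit] cong_mult_rcancel by blast
      show "g x = g y" if "coprime x (int q)" "[x = y] (mod int q)" for x y
        unfolding g_def using q_pos that by (rule kloosterman_term_cong)
    qed (use q_pos in auto)
    also have "\<dots> = kloosterman a b q"
      by (simp add: kloosterman_eq[OF q_gt_1] g_def S_def)
    finally show ?thesis .
  qed
  have geometric: "(\<Sum>t<p. w x ^ t) = (if [a * x * x = b] (mod int p) then of_nat p else 0)"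
    if "x \<in> S" for x
  proof -
    have x: "coprime x (int q)" using that by (simp add: S_def)
    have "w x = 1 \<longleftrightarrow> int q dvd Q * d x"
      unfolding w_def by (rule add_char_eq_1_iff[OF q_pos])
    also have "\<dots> \<longleftrightarrow> int p dvd d x"
      using p(1) by (simp add: q_eq Q_def mult.commute)
    also have "\<dots> \<longleftrightarrow> int p dvd d x * x"
      using x p(1) by (auto simp: coprime_q_iff prime_dvd_mult_iff)
    also have "d x * x = a * x * x - b * (x * inv_mod q x)"
      by (simp add: d_def algebra_simps)
    also have "int p dvd \<dots> \<longleftrightarrow> [a * x * x = b * (x * inv_mod q x)] (mod int p)"
      by (simp add: cong_iff_dvd_diff)
    also have "\<dots> \<longleftrightarrow> [a * x * x = b] (mod int p)"
      using cong_scalar_left[OF inv_mod_p[OF x], of b] by (metis cong_sym cong_trans mult.right_neutral)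
    finally have eq_1: "w x = 1 \<longleftrightarrow> [a * x * x = b] (mod int p)" .
    have "w x ^ p = add_char q (int p * (Q * d x))"
      by (simp add: w_def add_char_power)
    also have "\<dots> = 1"
      by (simp add: add_char_eq_1_iff[OF q_pos] q_eq Q_def mult.assoc[symmetric])
    finally have "w x ^ p = 1" .
    then show ?thesis
      using eq_1 by (auto simp: geometric_sum)
  qed
  have "of_nat p * kloosterman a b q = (\<Sum>t<p. \<Sum>x\<in>S. g x * w x ^ t)"
    by (simp add: shift)
  also have "\<dots> = (\<Sum>x\<in>S. g x * (\<Sum>t<p. w x ^ t))"
    by (subst sum.swap) (simp add: sum_distrib_left)
  also have "\<dots> = (\<Sum>x\<in>S. if [a * x * x = b] (mod int p) then of_nat p * g x else 0)"
    by (rule sum.cong) (simp_all add: geometric)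
  also have "\<dots> = (\<Sum>x\<in>{x \<in> S. [a * x * x = b] (mod int p)}. of_nat p * g x)"
    by (rule sum.inter_filter[OF fin, symmetric])
  also have "\<dots> = of_nat p * (\<Sum>x\<in>{x \<in> S. [a * x * x = b] (mod int p)}. g x)"
    by (simp add: sum_distrib_left)
  finally have "kloosterman a b q = (\<Sum>x\<in>{x \<in> S. [a * x * x = b] (mod int p)}. g x)"
    using p(1) by simp
  then show ?thesis
    by (simp add: S_def g_def)
qed

text \<open>The contribution of \<open>x \<equiv> 1\<close> modulo \<open>p\<close> to \<open>K(v, v; q)\<close>.\<close>

definition stationary_sum :: "int \<Rightarrow> complex" where
  "stationary_sum v = (\<Sum>x | x \<in> {0..<int q} \<and> principal x. add_char q (v * x + v * inv_mod q x))"

text \<open>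
  The quadratic Gauss sum restricted to the multiples \<open>z = x - 1\<close> of \<open>p\<close>. It is written in
  terms of the principal \<open>x\<close> so that the substitutions below map one and the same set of
  residues to itself.
\<close>

definition local_gauss_sum :: "int \<Rightarrow> complex" where
  "local_gauss_sum v = (\<Sum>x | x \<in> {0..<int q} \<and> principal x. add_char q (v * ((x - 1) * (x - 1))))"

text \<open>
  For \<open>a = b = v\<close> the stationary points are \<open>1\<close> and \<open>-1\<close> modulo \<open>p\<close>; negating \<open>x\<close> exchanges
  them and turns \<open>v\<close> into \<open>- v\<close>.
\<close>

lemma kloosterman_diagonal:
  assumes v: "coprime v (int q)"
  shows "kloosterman v v q = stationary_sum v + stationary_sum (- v)"
proof -
  define g where "g x = add_char q (v * x + v * inv_mod q x)" for x
  let ?A = "{x. x \<in> {0..<int q} \<and> principal x}"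
  let ?B = "{x. x \<in> {0..<int q} \<and> [x = -1] (mod int p)}"
  have fin: "finite ?A" "finite ?B"
    by (rule finite_subset[of _ "{0..<int q}"]; auto)+
  have coprime_minus: "coprime x (int q)" if "[x = -1] (mod int p)" for x
    using that p(1) cong_dvd_iff[of x "-1" "int p"] by (auto simp: coprime_q_iff)
  have False if "principal x" "[x = -1] (mod int p)" for x
  proof -
    have "[1 = -1] (mod int p)"
      using that cong_sym cong_trans by blast
    then show False
      using not_p_dvd_2 by (simp add: cong_iff_dvd_diff)
  qed
  then have disj: "?A \<inter> ?B = {}"
    by blast
  have roots: "[v * x * x = v] (mod int p) \<longleftrightarrow> principal x \<or> [x = -1] (mod int p)" for x
  proof -
    have "[v * x * x = v] (mod int p) \<longleftrightarrow> int p dvd v * ((x - 1) * (x + 1))"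
      by (simp add: cong_iff_dvd_diff algebra_simps)
    then show ?thesis
      using p(1) v by (simp add: cong_iff_dvd_diff coprime_q_iff prime_dvd_mult_iff)
  qed
  have "kloosterman v v q = (\<Sum>x\<in>?A \<union> ?B. g x)"
    unfolding kloosterman_stationary g_def roots
    by (intro sum.cong) (auto intro: principal_coprime coprime_minus)
  also have "\<dots> = (\<Sum>x\<in>?A. g x) + (\<Sum>x\<in>?B. g x)"
    by (rule sum.union_disjoint[OF fin disj])
  also have "(\<Sum>x\<in>?A. g x) = stationary_sum v"
    by (simp add: g_def stationary_sum_def)
  also have "(\<Sum>x\<in>?B. g x) = stationary_sum (- v)"
    unfolding stationary_sum_def
  proof (rule sum.reindex_bij_witness[where i = "\<lambda>x. int q - x" and j = "\<lambda>x. int q - x"])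
    show "int q - x \<in> ?A" if x: "x \<in> ?B" for x
    proof -
      have "x \<noteq> 0"
        using x p(1) by (auto simp: cong_iff_dvd_diff)
      moreover have "int q - x - 1 = int q - (x - (-1))" by simp
      ultimately show ?thesis
        using x p_dvd_q by (simp only: cong_iff_dvd_diff mem_Collect_eq) (auto intro: dvd_diff)
    qed
    show "int q - x \<in> ?B" if x: "x \<in> ?A" for x
    proof -
      have "x \<noteq> 0"
        using x p(1) by (auto simp: cong_iff_dvd_diff)
      moreover have "int q - x - (-1) = int q - (x - 1)" by simp
      ultimately show ?thesis
        using x p_dvd_q by (simp only: cong_iff_dvd_diff mem_Collect_eq) (auto intro: dvd_diff)
    qed
    show "add_char q (- v * (int q - x) + - v * inv_mod q (int q - x)) = g x" if "x \<in> ?B" for x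
    proof -
      have x: "coprime x (int q)"
        using that coprime_minus by simp
      have neg: "[int q - x = - x] (mod int q)"
        by (simp add: cong_iff_dvd_diff)
      have "[(int q - x) * (- inv_mod q x) = (- x) * (- inv_mod q x)] (mod int q)"
        by (intro cong_mult neg cong_refl)
      then have "[(int q - x) * (- inv_mod q x) = 1] (mod int q)"
        using cong_modular_inverse1[OF x] by (simp add: cong_trans)
      then have inv: "[inv_mod q (int q - x) = - inv_mod q x] (mod int q)"
        by (rule inv_mod_unique)
      have "add_char q (- v * (int q - x) + - v * inv_mod q (int q - x)) =
          add_char q (- v * (- x) + - v * (- inv_mod q x))"
        by (intro add_char_cong[OF q_pos] cong_add cong_mult cong_refl neg inv)
      then show ?thesis
        by (simp add: g_def)
    qed
  qed auto
  finally show ?thesis .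
qed

text \<open>
  With \<open>x = y\<^sup>2\<close> the phase \<open>v (x + 1/x)\<close> is \<open>2 v + v (y - 1/y)\<^sup>2\<close>, and
  \<open>y \<mapsto> y - 1/y + 1\<close> permutes the principal residues.
\<close>

lemma stationary_sum_eq: "stationary_sum v = add_char q (2 * v) * local_gauss_sum v"
proof -
  let ?S = "{x. x \<in> {0..<int q} \<and> principal x}"
  let ?f = "\<lambda>y. add_char q (v * ((y - 1) * (y - 1)))"
  have "stationary_sum v = (\<Sum>x\<in>?S. add_char q (v * (x * x) + v * inv_mod q (x * x)))"
    unfolding stationary_sum_def
    by (rule sum_principal_square[symmetric])
      (intro kloosterman_term_cong q_pos principal_coprime)
  also have "\<dots> = (\<Sum>x\<in>?S. add_char q (2 * v) * ?f (x - inv_mod q x + 1))"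
  proof (rule sum.cong[OF refl])
    fix x assume "x \<in> ?S"
    then have x: "coprime x (int q)" by (simp add: principal_coprime)
    define y where "y = inv_mod q x"
    have xy: "[x * y = 1] (mod int q)"
      unfolding y_def by (rule cong_modular_inverse1[OF x])
    have "[(x * y) * (x * y) = 1 * 1] (mod int q)"
      by (intro cong_mult xy)
    then have inv: "[inv_mod q (x * x) = y * y] (mod int q)"
      by (intro inv_mod_unique) (simp add: mult_ac)
    have "[v * (x * x) + v * inv_mod q (x * x) = v * (x * x) + v * (y * y)] (mod int q)"
      by (intro cong_add cong_mult cong_refl inv)
    also have "v * (x * x) + v * (y * y) = 2 * v * (x * y) + v * ((x - y) * (x - y))"
      by (simp add: algebra_simps)
    also have "[\<dots> = 2 * v * 1 + v * ((x - y) * (x - y))] (mod int q)"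
      by (intro cong_add cong_mult cong_refl xy)
    finally have "add_char q (v * (x * x) + v * inv_mod q (x * x)) =
        add_char q (2 * v * 1 + v * ((x - y) * (x - y)))"
      by (rule add_char_cong[OF q_pos])
    then show "add_char q (v * (x * x) + v * inv_mod q (x * x)) =
        add_char q (2 * v) * ?f (x - inv_mod q x + 1)"
      by (simp add: add_char_add y_def)
  qed
  also have "\<dots> = add_char q (2 * v) * (\<Sum>x\<in>?S. ?f (x - inv_mod q x + 1))"
    by (simp add: sum_distrib_left)
  also have "(\<Sum>x\<in>?S. ?f (x - inv_mod q x + 1)) = local_gauss_sum v"
    unfolding local_gauss_sum_def
  proof (rule sum_residue_reindex)
    show "0 < int q" using q_pos by simp
    show "principal y" if "[x = y] (mod int q)" "principal x" for x y
      using that by (rule principal_cong)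
    show "principal (x - inv_mod q x + 1)" if "principal x" for x
      using cong_add[OF cong_diff[OF that principal_inv_mod[OF that]] cong_refl[of 1]] by simp
    show "?f x = ?f y" if "[x = y] (mod int q)" for x y
      by (intro add_char_cong[OF q_pos] cong_mult cong_diff cong_refl that)
    fix x y assume x: "principal x" and y: "principal y"
      and eq: "[x - inv_mod q x + 1 = y - inv_mod q y + 1] (mod int q)"
    define x' y' where "x' = inv_mod q x" and "y' = inv_mod q y"
    have unit: "int q dvd x * x' - 1" "int q dvd y * y' - 1"
      using cong_modular_inverse1[OF principal_coprime] x y
      by (auto simp: cong_iff_dvd_diff x'_def y'_def)
    have diff: "int q dvd (x - x') - (y - y')"
      using eq by (simp add: cong_iff_dvd_diff x'_def y'_def)
    \<comment> \<open>Modulo \<open>q\<close>, \<open>(x - y) (1 + x' y')\<close> is the difference of \<open>x - x'\<close> and \<open>y - y'\<close>.\<close>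
    have "int q dvd ((x - x') - (y - y')) + (x * x' - 1) * y' - (y * y' - 1) * x'"
      by (rule dvd_diff[OF dvd_add[OF diff dvd_mult2[OF unit(1)]] dvd_mult2[OF unit(2)]])
    also have "((x - x') - (y - y')) + (x * x' - 1) * y' - (y * y' - 1) * x' = (x - y) * (1 + x' * y')"
      by (simp add: algebra_simps)
    finally have "int q dvd (x - y) * (1 + x' * y')" .
    moreover have "[1 + x' * y' = 2] (mod int p)"
      unfolding one_add_one[symmetric]
      unfolding x'_def y'_def
      by (intro cong_add cong_refl principal_mult principal_inv_mod x y)
    ultimately have "int q dvd x - y"
      by (rule dvd_mult_unit_2)
    then show "[x = y] (mod int q)"
      by (simp add: cong_iff_dvd_diff)
  qed
  finally show ?thesis .
qed

text \<open>If \<open>t = s\<^sup>2\<close>, the factor \<open>t\<close> is absorbed by replacing \<open>x - 1\<close> with \<open>s (x - 1)\<close>.\<close>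

lemma local_gauss_sum_principal:
  assumes "principal t"
  shows "local_gauss_sum (v * t) = local_gauss_sum v"
proof -
  obtain s where s: "principal s" "[s * s = t] (mod int q)"
    using principal_square_root[OF assms] .
  let ?f = "\<lambda>y. add_char q (v * ((y - 1) * (y - 1)))"
  let ?S = "{x. x \<in> {0..<int q} \<and> principal x}"
  have "local_gauss_sum (v * t) = (\<Sum>x\<in>?S. ?f (s * (x - 1) + 1))"
    unfolding local_gauss_sum_def
  proof (rule sum.cong[OF refl])
    fix x
    have "add_char q (v * t * ((x - 1) * (x - 1))) = add_char q (v * (s * s) * ((x - 1) * (x - 1)))"
      by (intro add_char_cong[OF q_pos] cong_mult cong_refl cong_sym[OF s(2)])
    then show "add_char q (v * t * ((x - 1) * (x - 1))) = ?f (s * (x - 1) + 1)"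
      by (simp add: mult_ac)
  qed
  also have "\<dots> = local_gauss_sum v"
    unfolding local_gauss_sum_def
  proof (rule sum_residue_reindex)
    show "0 < int q" using q_pos by simp
    show "principal y" if "[x = y] (mod int q)" "principal x" for x y
      using that by (rule principal_cong)
    show "principal (s * (x - 1) + 1)" if "principal x" for x
      using that by (simp add: cong_iff_dvd_diff)
    show "?f x = ?f y" if "[x = y] (mod int q)" for x y
      by (intro add_char_cong[OF q_pos] cong_mult cong_diff cong_refl that)
    show "[x = y] (mod int q)" if "[s * (x - 1) + 1 = s * (y - 1) + 1] (mod int q)" for x y
    proof -
      have "int q dvd s * (x - y)"
        using that by (simp add: cong_iff_dvd_diff algebra_simps)
      then show ?thesis
        using principal_coprime[OF s(1)]
        by (simp add: coprime_dvd_mult_right_iff coprime_commute cong_iff_dvd_diff)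
    qed
  qed
  finally show ?thesis .
qed

lemma kloosterman_square_class:
  assumes c: "coprime c (int q)" and s: "principal s"
  shows "kloosterman (c * c * (s * s)) 1 q =
    add_char q (2 * c * s) * local_gauss_sum c + add_char q (- (2 * c * s)) * local_gauss_sum (- c)"
proof -
  have v: "coprime (c * s) (int q)"
    using c principal_coprime[OF s] by simp
  have "kloosterman (c * c * (s * s)) 1 q = kloosterman ((c * s) * (c * s)) 1 q"
    by (simp add: mult_ac)
  also have "\<dots> = kloosterman (c * s) (c * s) q"
    using kloosterman_scale[OF q_gt_1 v, of "c * s" 1] by simp
  also have "\<dots> = add_char q (2 * (c * s)) * local_gauss_sum (c * s)
      + add_char q (2 * (- c * s)) * local_gauss_sum (- c * s)"
    by (simp add: kloosterman_diagonal[OF v] stationary_sum_eq)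
  finally show ?thesis
    unfolding local_gauss_sum_principal[OF s] by (simp add: mult_ac)
qed

text \<open>The shift \<open>x \<mapsto> x + p\<close> multiplies the sum by \<open>e(p m) \<noteq> 1\<close>.\<close>

lemma add_char_sum_principal:
  assumes "\<not> int q dvd int p * m"
  shows "(\<Sum>x | x \<in> {0..<int q} \<and> principal x. add_char q (m * x)) = 0" (is "?s = 0")
proof -
  have "?s = (\<Sum>x | x \<in> {0..<int q} \<and> principal x. add_char q (m * (x + int p)))"
  proof (rule sum_residue_reindex[symmetric])
    show "0 < int q" using q_pos by simp
    show "principal y" if "[x = y] (mod int q)" "principal x" for x y
      using that by (rule principal_cong)
    show "principal (x + int p)" if "principal x" for x
      using cong_add[OF that, of "int p" 0] by (simp add: cong_0_iff)
    show "[x = y] (mod int q)" if "[x + int p = y + int p] (mod int q)" for x y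
      using that by (simp add: cong_add_rcancel)
    show "add_char q (m * x) = add_char q (m * y)" if "[x = y] (mod int q)" for x y
      by (intro add_char_cong[OF q_pos] cong_mult cong_refl that)
  qed
  also have "\<dots> = ?s * add_char q (int p * m)"
    by (simp only: distrib_left add_char_add sum_distrib_right mult.commute[of m "int p"])
  finally show ?thesis
    using assms add_char_eq_1_iff[OF q_pos, of "int p * m"] by simp
qed

text \<open>
  Expanding the power of the two-term formula leaves frequencies \<open>2 c (2 k - n)\<close>. Oddness of \<open>n\<close>
  keeps \<open>2 k - n\<close> away from 0, and its size keeps it away from the other multiples of
  \<open>p\<^sup>r\<^sup>-\<^sup>1\<close>.
\<close>

lemma sum_kloosterman_power_square_class:
  assumes c: "coprime c (int q)" and n: "odd n" "n < p ^ (r - 1)"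
  shows "(\<Sum>w | w \<in> {0..<int q} \<and> principal w. kloosterman (c * c * w) 1 q ^ n) = 0"
proof -
  let ?S = "{x. x \<in> {0..<int q} \<and> principal x}"
  define m where "m k = 2 * c * (2 * int k - int n)" for k
  define C where "C k = of_nat (n choose k) * local_gauss_sum c ^ k * local_gauss_sum (- c) ^ (n - k)" for k
  have "(\<Sum>w\<in>?S. kloosterman (c * c * w) 1 q ^ n) =
      (\<Sum>s\<in>?S. kloosterman (c * c * (s * s)) 1 q ^ n)"
  proof (rule sum_principal_square[symmetric])
    show "kloosterman (c * c * x) 1 q ^ n = kloosterman (c * c * y) 1 q ^ n"
      if "[x = y] (mod int q)" for x y
      using kloosterman_cong[OF q_gt_1 cong_scalar_left[OF that]] by simp
  qed
  also have "\<dots> = (\<Sum>s\<in>?S. \<Sum>k\<le>n. C k * add_char q (m k * s))"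
  proof (rule sum.cong[OF refl])
    fix s assume "s \<in> ?S"
    then have s: "principal s" by simp
    show "kloosterman (c * c * (s * s)) 1 q ^ n = (\<Sum>k\<le>n. C k * add_char q (m k * s))"
      unfolding kloosterman_square_class[OF c s] binomial_ring
    proof (rule sum.cong[OF refl])
      fix k assume "k \<in> {..n}"
      then have "m k * s = int k * (2 * c * s) + int (n - k) * (- (2 * c * s))"
        by (simp add: m_def algebra_simps)
      then have "add_char q (m k * s) = add_char q (2 * c * s) ^ k * add_char q (- (2 * c * s)) ^ (n - k)"
        by (simp only: add_char_add add_char_power)
      then show "of_nat (n choose k) * (add_char q (2 * c * s) * local_gauss_sum c) ^ k *
          (add_char q (- (2 * c * s)) * local_gauss_sum (- c)) ^ (n - k) = C k * add_char q (m k * s)"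
        by (simp add: C_def power_mult_distrib mult_ac)
    qed
  qed
  also have "\<dots> = (\<Sum>k\<le>n. C k * (\<Sum>s\<in>?S. add_char q (m k * s)))"
    by (subst sum.swap) (simp add: sum_distrib_left)
  also have "\<dots> = 0"
  proof (rule sum.neutral, rule ballI)
    fix k assume k: "k \<in> {..n}"
    have "\<not> int q dvd int p * m k"
    proof
      assume "int q dvd int p * m k"
      then have "int p ^ (r - 1) dvd m k"
        using p(1) by (simp add: q_eq)
      moreover have "coprime (int p ^ (r - 1)) (2 * c)"
      proof -
        have "coprime (int p) 2"
          using p(2) by simp
        moreover have "coprime (int p) c"
          using c r unfolding q_def by (simp add: coprime_commute)
        ultimately show ?thesis
          by simp
      qed
      ultimately have dvd: "int p ^ (r - 1) dvd 2 * int k - int n"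
        unfolding m_def by (simp add: coprime_dvd_mult_right_iff)
      have "2 * int k - int n \<noteq> 0"
        using n(1) by presburger
      then have "int p ^ (r - 1) \<le> \<bar>2 * int k - int n\<bar>"
        using dvd zdvd_imp_le[of "int p ^ (r - 1)" "\<bar>2 * int k - int n\<bar>"] by simp
      also have "\<dots> \<le> int n"
        using k by simp
      finally show False
        using n(2) by (metis linorder_not_less of_nat_le_iff of_nat_power)
    qed
    then show "C k * (\<Sum>s\<in>?S. add_char q (m k * s)) = 0"
      using add_char_sum_principal by simp
  qed
  finally show ?thesis .
qed

lemma sum_kloosterman_power_principal:
  assumes n: "odd n" "n < p ^ (r - 1)"
  shows "(\<Sum>w | w \<in> {0..<int q} \<and> principal w. kloosterman (u * w) 1 q ^ n) = 0"
proof (cases "\<exists>w. principal w \<and> kloosterman (u * w) 1 q \<noteq> 0")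
  case False
  have "n > 0"
    using n(1) by (rule odd_pos)
  with False show ?thesis
    by (intro sum.neutral) auto
next
  case True
  then obtain w where w: "principal w" "kloosterman (u * w) 1 q \<noteq> 0"
    by blast
  then obtain x where x: "coprime x (int q)" "[u * w * x * x = 1] (mod int p)"
    unfolding kloosterman_stationary by (auto elim!: sum.not_neutral_contains_not_neutral)
  have "[u * x * x * w = u * x * x * 1] (mod int p)"
    by (intro cong_mult cong_refl w)
  then have "principal (u * x * x)"
    using x(2) by (simp add: mult_ac) (metis cong_sym cong_trans)
  then obtain s where s: "principal s" "[s * s = u * x * x] (mod int q)"
    by (rule principal_square_root)
  \<comment> \<open>\<open>u\<close> is a square modulo \<open>p\<close>, namely that of \<open>1/x\<close>; the root \<open>s\<close> of the principal defect
    \<open>u x\<^sup>2\<close> corrects it to a square root modulo \<open>q\<close>.\<close>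
  define c where "c = inv_mod q x * s"
  have c: "coprime c (int q)"
    unfolding c_def using coprime_modular_inverse[OF x(1)] principal_coprime[OF s(1)] by simp
  have "c * c = inv_mod q x * inv_mod q x * (s * s)"
    by (simp add: c_def)
  also have "[\<dots> = inv_mod q x * inv_mod q x * (u * x * x)] (mod int q)"
    by (intro cong_mult cong_refl s)
  also have "inv_mod q x * inv_mod q x * (u * x * x) = u * ((x * inv_mod q x) * (x * inv_mod q x))"
    by simp
  also have "[\<dots> = u * (1 * 1)] (mod int q)"
    by (intro cong_mult cong_refl cong_modular_inverse1[OF x(1)])
  finally have "[c * c = u] (mod int q)"
    by simp
  then have "kloosterman (u * w) 1 q = kloosterman (c * c * w) 1 q" for w
    by (intro kloosterman_cong[OF q_gt_1] cong_mult cong_refl) (rule cong_sym)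
  then show ?thesis
    using sum_kloosterman_power_square_class[OF c n] by simp
qed

text \<open>
  Averaging the moment over the substitutions \<open>u \<mapsto> u w\<close> reduces it to sums over the cosets
  of the principal residues.
\<close>

theorem kloosterman_moment_odd_prime_power:
  assumes n: "odd n" "n < p ^ (r - 1)"
  shows "kloosterman_moment n q = 0"
proof -
  let ?S = "{x. x \<in> {0..<int q} \<and> principal x}"
  have fin: "finite ?S"
    by (rule finite_subset[of _ "{0..<int q}"]) auto
  have "of_nat (card ?S) * kloosterman_moment n q = (\<Sum>w\<in>?S. kloosterman_moment n q)"
    by simp
  also have "\<dots> = (\<Sum>w\<in>?S. \<Sum>u\<in>{0..<int q}. kloosterman (u * w) 1 q ^ n)"
  proof (rule sum.cong[OF refl])
    fix w assume "w \<in> ?S"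
    then have "coprime w (int q)"
      by (simp add: principal_coprime)
    then show "kloosterman_moment n q = (\<Sum>u\<in>{0..<int q}. kloosterman (u * w) 1 q ^ n)"
      by (intro kloosterman_moment_reindex[OF q_gt_1]) (simp add: cong_mult_rcancel)
  qed
  also have "\<dots> = (\<Sum>u\<in>{0..<int q}. \<Sum>w\<in>?S. kloosterman (u * w) 1 q ^ n)"
    by (rule sum.swap)
  also have "\<dots> = 0"
    by (simp only: sum_kloosterman_power_principal[OF n] sum.neutral_const)
  finally have "of_nat (card ?S) * kloosterman_moment n q = 0" .
  moreover have "1 \<in> ?S"
    using q_gt_1 by simp
  then have "card ?S \<noteq> 0"
    using fin by (metis card_eq_0_iff empty_iff)
  ultimately show ?thesis
    by (metis mult_eq_0_iff of_nat_eq_0_iff)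
qed

end

theorem theorem3:
  fixes n p r :: nat
  assumes "n \<ge> 1" and "odd n" and "prime p" and "r > 0"
  shows "(odd p \<longrightarrow> real r > log (real p) (real n) + 1 \<longrightarrow> kloosterman_moment n (p ^ r) = 0) \<and>
         (p = 2 \<longrightarrow> r > 1 \<longrightarrow> kloosterman_moment n (2 ^ r) = 0)"
proof (intro conjI impI)
  assume odd: "odd p" and r: "real r > log (real p) (real n) + 1"
  have p: "real p > 1"
    using \<open>prime p\<close> prime_gt_1_nat by simp
  have "log (real p) (real n) \<ge> 0"
    using p \<open>n \<ge> 1\<close> by simp
  with r have r2: "r \<ge> 2"
    by linarith
  have "log (real p) (real n) < real (r - 1)"
    using r r2 by simp
  then have "real n < real p powr real (r - 1)"
    using p \<open>n \<ge> 1\<close> by (simp add: log_less_iff)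
  also have "\<dots> = real (p ^ (r - 1))"
    using p by (simp add: powr_realpow)
  finally have "n < p ^ (r - 1)"
    by simp
  then show "kloosterman_moment n (p ^ r) = 0"
    using kloosterman_moment_odd_prime_power \<open>prime p\<close> odd r2 \<open>odd n\<close> by blast
next
  assume "r > 1"
  then show "kloosterman_moment n (2 ^ r) = 0"
    using \<open>odd n\<close> by (intro kloosterman_moment_even_modulus) auto
qed

end
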